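(* Let $K$ be a field of characteristic zero, let $n\ge 1$, and let $P_1,\dots,P_n\in K_{\langle n\rangle}=K\langle X_1,\dots,X_n\rangle$. The following conditions are equivalent: (i) there is $P\in K_{\langle n\rangle}$ such that $\delta_j P=P_j$ for all $1\le j\le n$; (ii) $\sum_{1\le j\le n}[X_j,P_j]=0$; (iii) $\sum_{1\le j\le n}X_jP_j\in CK_{\langle n\rangle}$; (iv) $\delta_k\left(\sum_{1\le j\le n}X_jP_j\right)=(N+I)P_k$ for all $1\le k\le n$, where $I$ denotes the identity map of $K_{\langle n\rangle}$.
   Context: $K$ is a field of characteristic zero and $K_{\langle n\rangle}=K\langle X_1,\dots,X_n\rangle$ is the ring of polynomials in the noncommuting indeterminates $X_1,\dots,X_n$ with coefficients in $K$ (the free associative unital $K$-algebra). $[a,b]=ab-ba$. The partial generalized difference quotients $\partial_j:K_{\langle n\rangle}\to K_{\langle n\rangle}\otimes_K K_{\langle n\rangle}$ ($1\le j\le n$) are the ($K$-linear) derivations such that $\partial_jX_k=0$ if $k\ne j$ and $\partial_jX_j=1\otimes 1$, where $K_{\langle n\rangle}\otimes_K K_{\langle n\rangle}$ has the bimodule structure $a(b\otimes c)=ab\otimes c$, $(b\otimes c)d=b\otimes cd$. The partial cyclic derivatives are the linear maps $\delta_j=\tilde\mu\circ\partial_j:K_{\langle n\rangle}\to K_{\langle n\rangle}$, where $\tilde\mu(a\otimes b)=ba$. The number operator $N:K_{\langle n\rangle}\to K_{\langle n\rangle}$ is the linear map with $N1=0$ and $NX_{i_1}\cdots X_{i_k}=kX_{i_1}\cdots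 X_{i_k}$. $C:K_{\langle n\rangle}\to K_{\langle n\rangle}$ is the linear map with $C1=0$ and, for $p\ge 1$, $CX_{i_1}\cdots X_{i_p}=\sum_{1\le j\le p}X_{i_{j+1}}\cdots X_{i_p}X_{i_1}\cdots X_{i_j}$. The cyclic subspace $CK_{\langle n\rangle}$ is the vector subspace spanned by all cyclic symmetrizations $CX_{i_1}\cdots X_{i_p}$ of monomials, i.e. the image of $C$ (nonzero constants are not in it). *)

theory Defs
  imports Complex_Main "HOL-Library.Poly_Mapping"
begin

section \<open>Free vector spaces\<close>

definition fscale :: "'k \<Rightarrow> ('a \<Rightarrow>\<^sub>0 'k::field) \<Rightarrow> ('a \<Rightarrow>\<^sub>0 'k)"
  where "fscale c p = Poly_Mapping.map ((*) c) p"

lemma lookup_fscale [simp]: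
  "Poly_Mapping.lookup (fscale c p) k = c * Poly_Mapping.lookup p k"
  unfolding fscale_def by transfer (simp add: when_def)

interpretation free_vs: vector_space "fscale :: 'k::field \<Rightarrow> ('a \<Rightarrow>\<^sub>0 'k) \<Rightarrow> ('a \<Rightarrow>\<^sub>0 'k)"
  by unfold_locales (auto intro!: poly_mapping_eqI simp: lookup_add algebra_simps)

text \<open>The linear extension to the free vector space on \<open>'a\<close> of a map \<open>f\<close> given on the basis.\<close>

definition lin_ext :: "('k \<Rightarrow> 'c \<Rightarrow> 'c) \<Rightarrow> ('a \<Rightarrow> 'c) \<Rightarrow> ('a \<Rightarrow>\<^sub>0 'k::field) \<Rightarrow> 'c::ab_group_add"
  where "lin_ext s f p = (\<Sum>k\<in>Poly_Mapping.keys p. s (Poly_Mapping.lookup p k) (f k))"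

lemma lin_ext_superset:
  assumes "vector_space s" "finite A" "Poly_Mapping.keys p \<subseteq> A"
  shows "lin_ext s f p = (\<Sum>k\<in>A. s (Poly_Mapping.lookup p k) (f k))"
proof -
  interpret vector_space s by fact
  show ?thesis
    unfolding lin_ext_def
    by (rule sum.mono_neutral_left) (use assms in \<open>auto simp: in_keys_iff\<close>)
qed

lemma linear_lin_ext:
  assumes "vector_space s"
  shows "Vector_Spaces.linear fscale s (lin_ext s f)"
proof -
  interpret vector_space s by fact
  have add: "lin_ext s f (p + q) = lin_ext s f p + lin_ext s f q" for p q
  proof -
    let ?A = "Poly_Mapping.keys p \<union> Poly_Mapping.keys q"
    have "Poly_Mapping.keys (p + q) \<subseteq> ?A" by (rule keys_add)
    then show ?thesis
      by (simp add: lin_ext_superset[OF assms, of ?A] lookup_add scale_left_distrib sum.distrib)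
  qed
  have sc: "lin_ext s f (fscale c p) = s c (lin_ext s f p)" for c p
  proof -
    have "Poly_Mapping.keys (fscale c p) \<subseteq> Poly_Mapping.keys p"
      by (auto simp: in_keys_iff)
    then show ?thesis
      by (simp add: lin_ext_superset[OF assms, of "Poly_Mapping.keys p"] scale_sum_right)
  qed
  show ?thesis
    using assms add sc free_vs.vector_space_axioms by (simp add: Vector_Spaces.linear_iff)
qed

lemma lin_ext_single [simp]:
  assumes "vector_space s"
  shows "lin_ext s f (Poly_Mapping.single k 1) = f k"
proof -
  interpret vector_space s by fact
  show ?thesis by (simp add: lin_ext_def)
qed

lemma poly_mapping_expand:
  "(\<Sum>k\<in>Poly_Mapping.keys p. fscale (Poly_Mapping.lookup p k) (Poly_Mapping.single k 1)) = p"
  by (rule poly_mapping_eqI)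
     (auto simp: lookup_sum lookup_single when_def in_keys_iff if_distrib[of "(*) _"] sum.delta' cong: if_cong)

lemma linear_eq_lin_ext:
  assumes "Vector_Spaces.linear fscale s g"
  shows "g p = lin_ext s (\<lambda>k. g (Poly_Mapping.single k 1)) p"
proof -
  interpret Vector_Spaces.linear fscale s g by fact
  have "g p = g (\<Sum>k\<in>Poly_Mapping.keys p. fscale (Poly_Mapping.lookup p k) (Poly_Mapping.single k 1))"
    by (simp only: poly_mapping_expand)
  then show ?thesis by (simp add: sum scale lin_ext_def)
qed

lemma linear_eqI:
  assumes "Vector_Spaces.linear fscale s g" "Vector_Spaces.linear fscale s h"
    and "\<And>k. g (Poly_Mapping.single k 1) = h (Poly_Mapping.single k 1)"
  shows "g = h"
proof (rule ext)
  fix p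
  have "g p = lin_ext s (\<lambda>k. g (Poly_Mapping.single k 1)) p"
    by (rule linear_eq_lin_ext[OF assms(1)])
  also have "\<dots> = lin_ext s (\<lambda>k. h (Poly_Mapping.single k 1)) p"
    by (simp only: assms(3))
  also have "\<dots> = h p"
    by (rule linear_eq_lin_ext[OF assms(2), symmetric])
  finally show "g p = h p" .
qed

lemmas linear_lin_ext_free [simp] = linear_lin_ext[OF free_vs.vector_space_axioms]
lemmas lin_ext_single_free [simp] = lin_ext_single[OF free_vs.vector_space_axioms]

lemma linearD:
  assumes "Vector_Spaces.linear r s g"
  shows "g (x + y) = g x + g y" "g (r c x) = s c (g x)"
  using assms by (simp_all add: Vector_Spaces.linear_iff)


section \<open>Noncommutative polynomials\<close>

text \<open>
  Words in the letters \<open>'n\<close>, with concatenation written additively, so that the convolution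
  product of \<^theory>\<open>HOL-Library.Poly_Mapping\<close> makes \<open>'n ncmon \<Rightarrow>\<^sub>0 'k\<close> the
  free associative unital algebra. The indeterminates are indexed by \<open>'n\<close>.
\<close>

datatype 'n ncmon = Mon (letters: "'n list")

instantiation ncmon :: (type) monoid_add
begin

definition zero_ncmon :: "'a ncmon"
  where "0 = Mon []"

definition plus_ncmon :: "'a ncmon \<Rightarrow> 'a ncmon \<Rightarrow> 'a ncmon"
  where "u + v = Mon (letters u @ letters v)"

instance
  by standard (auto simp: zero_ncmon_def plus_ncmon_def)

end

type_synonym ('n, 'k) ncpoly = "'n ncmon \<Rightarrow>\<^sub>0 'k"

definition mon :: "'n list \<Rightarrow> ('n, 'k::field) ncpoly"
  where "mon w = Poly_Mapping.single (Mon w) 1"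

definition ncvar :: "'n \<Rightarrow> ('n, 'k::field) ncpoly"
  where "ncvar j = mon [j]"

definition commutator :: "('n, 'k::field) ncpoly \<Rightarrow> ('n, 'k) ncpoly \<Rightarrow> ('n, 'k) ncpoly"
  where "commutator a b = a * b - b * a"

lemma mon_Nil: "mon [] = 1"
  by (simp add: mon_def flip: zero_ncmon_def)

lemma mon_mult: "mon u * mon v = mon (u @ v)"
  by (simp add: mon_def mult_single plus_ncmon_def)

lemma single_eq_mon: "Poly_Mapping.single u 1 = mon (letters u)"
  by (simp add: mon_def)

lemma fscale_conv_mult: "fscale c p = Poly_Mapping.single 0 c * p"
  for p :: "('n, 'k::field) ncpoly"
  unfolding fscale_def by (rule mult_map_scale_conv_mult)

lemma fscale_single: "fscale c (Poly_Mapping.single u d) = Poly_Mapping.single u (c * d)"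
  by (rule poly_mapping_eqI) (simp add: lookup_single when_def)

lemma fscale_mult_left: "fscale c a * b = fscale c (a * b)"
  for a b :: "('n, 'k::field) ncpoly"
  by (simp only: fscale_conv_mult mult.assoc)

lemma fscale_conv_mult_right: "fscale c p = p * Poly_Mapping.single 0 c"
  for p :: "('n, 'k::field) ncpoly"
proof -
  have "Vector_Spaces.linear fscale fscale (\<lambda>p::('n, 'k) ncpoly. fscale c p)"
    by (simp add: Vector_Spaces.linear_iff free_vs.vector_space_axioms
        free_vs.scale_right_distrib mult.commute)
  moreover have "Vector_Spaces.linear fscale fscale (\<lambda>p::('n, 'k) ncpoly. p * Poly_Mapping.single 0 c)"
    by (simp add: Vector_Spaces.linear_iff free_vs.vector_space_axioms distrib_right fscale_mult_left)
  ultimately show ?thesis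
    by (rule fun_cong[OF linear_eqI]) (simp add: fscale_single mult_single)
qed

lemma fscale_mult_right: "a * fscale c b = fscale c (a * b)"
  for a b :: "('n, 'k::field) ncpoly"
  by (simp only: fscale_conv_mult_right mult.assoc)

lemmas fscale_mult = fscale_mult_left fscale_mult_right


section \<open>The tensor square\<close>

text \<open>
  The tensor product over \<open>'k\<close> of the free vector spaces on \<open>'a\<close> and \<open>'b\<close> is realised as the
  free vector space on \<open>'a \<times> 'b\<close>; \<open>tensor_universal\<close> is its universal property.
\<close>

type_synonym ('n, 'k) nctensor = "('n ncmon \<times> 'n ncmon) \<Rightarrow>\<^sub>0 'k"

definition tensor :: "('a \<Rightarrow>\<^sub>0 'k::field) \<Rightarrow> ('b \<Rightarrow>\<^sub>0 'k) \<Rightarrow> ('a \<times> 'b \<Rightarrow>\<^sub>0 'k)"  (infixr \<open>\<otimes>\<close> 75)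
  where "a \<otimes> b = lin_ext fscale (\<lambda>u. lin_ext fscale (\<lambda>v. Poly_Mapping.single (u, v) 1) b) a"

lemma tensor_single [simp]:
  "Poly_Mapping.single u 1 \<otimes> Poly_Mapping.single v 1 = Poly_Mapping.single (u, v) 1"
  by (simp add: tensor_def)

lemma linear_tensor_left: "Vector_Spaces.linear fscale fscale (\<lambda>a. a \<otimes> b)"
  by (simp add: tensor_def)

lemma linear_fscale_sum:
  assumes "\<And>k. Vector_Spaces.linear fscale fscale (f k)"
  shows "Vector_Spaces.linear fscale fscale (\<lambda>x. \<Sum>k\<in>A. fscale (c k) (f k x))"
  unfolding Vector_Spaces.linear_iff
proof (intro conjI allI free_vs.vector_space_axioms)
  fix x y
  show "(\<Sum>k\<in>A. fscale (c k) (f k (x + y))) =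
      (\<Sum>k\<in>A. fscale (c k) (f k x)) + (\<Sum>k\<in>A. fscale (c k) (f k y))"
    by (simp only: linearD(1)[OF assms] free_vs.scale_right_distrib sum.distrib)
next
  fix d x
  show "(\<Sum>k\<in>A. fscale (c k) (f k (fscale d x))) = fscale d (\<Sum>k\<in>A. fscale (c k) (f k x))"
    by (simp only: linearD(2)[OF assms] free_vs.scale_sum_right free_vs.scale_left_commute[of _ d])
qed

lemma linear_tensor_right: "Vector_Spaces.linear fscale fscale (\<lambda>b. a \<otimes> b)"
  unfolding tensor_def lin_ext_def[of _ _ a]
  by (rule linear_fscale_sum, rule linear_lin_ext_free)

lemma bilinear_eqI:
  assumes "\<And>b. Vector_Spaces.linear fscale s (\<lambda>a. f a b)" "\<And>a. Vector_Spaces.linear fscale s (f a)"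
    and "\<And>b. Vector_Spaces.linear fscale s (\<lambda>a. g a b)" "\<And>a. Vector_Spaces.linear fscale s (g a)"
    and "\<And>u v. f (Poly_Mapping.single u 1) (Poly_Mapping.single v 1)
             = g (Poly_Mapping.single u 1) (Poly_Mapping.single v 1)"
  shows "f a b = g a b"
proof -
  have "f (Poly_Mapping.single u 1) = g (Poly_Mapping.single u 1)" for u
    by (rule linear_eqI[OF assms(2,4)]) (rule assms(5))
  then have "(\<lambda>a. f a b) = (\<lambda>a. g a b)"
    by (intro linear_eqI[OF assms(1,3)]) simp
  then show ?thesis by (rule fun_cong)
qed

lemma linear_comp:
  assumes "Vector_Spaces.linear r s f" "Vector_Spaces.linear s t g"
  shows "Vector_Spaces.linear r t (\<lambda>x. g (f x))"
  using assms by (simp add: Vector_Spaces.linear_iff)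

theorem tensor_universal:
  fixes f :: "('a \<Rightarrow>\<^sub>0 'k::field) \<Rightarrow> ('b \<Rightarrow>\<^sub>0 'k) \<Rightarrow> 'c::ab_group_add"
  assumes "\<And>b. Vector_Spaces.linear fscale s (\<lambda>a. f a b)"
    and "\<And>a. Vector_Spaces.linear fscale s (f a)"
  shows "\<exists>!g. Vector_Spaces.linear fscale s g \<and> (\<forall>a b. g (a \<otimes> b) = f a b)"
proof (rule ex1I)
  have vs: "vector_space s" using assms(2) by (simp add: Vector_Spaces.linear_iff)
  define g where
    "g = lin_ext s (\<lambda>(u, v). f (Poly_Mapping.single u 1) (Poly_Mapping.single v 1))"
  have lin: "Vector_Spaces.linear fscale s g"
    unfolding g_def by (rule linear_lin_ext[OF vs])
  have g_single: "g (Poly_Mapping.single (u, v) 1)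
      = f (Poly_Mapping.single u 1) (Poly_Mapping.single v 1)" for u v
    by (simp add: g_def vs)
  have "g (a \<otimes> b) = f a b" for a b
    by (rule bilinear_eqI[where s = s and f = "\<lambda>a b. g (a \<otimes> b)" and g = f])
       (auto intro: assms linear_comp[OF linear_tensor_left lin] linear_comp[OF linear_tensor_right lin]
         simp: g_single)
  with lin show "Vector_Spaces.linear fscale s g \<and> (\<forall>a b. g (a \<otimes> b) = f a b)" by blast
  fix h assume h: "Vector_Spaces.linear fscale s h \<and> (\<forall>a b. h (a \<otimes> b) = f a b)"
  have "h (Poly_Mapping.single k 1) = g (Poly_Mapping.single k 1)" for k
  proof (cases k)
    case (Pair u v)
    have "h (Poly_Mapping.single u 1 \<otimes> Poly_Mapping.single v 1)
        = f (Poly_Mapping.single u 1) (Poly_Mapping.single v 1)"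
      using h by blast
    then show ?thesis by (simp add: Pair g_single)
  qed
  then show "h = g" using h lin by (intro linear_eqI) auto
qed

definition left_act :: "('n, 'k::field) ncpoly \<Rightarrow> ('n, 'k) nctensor \<Rightarrow> ('n, 'k) nctensor"
  where "left_act a = lin_ext fscale
    (\<lambda>(u, v). (a * Poly_Mapping.single u 1) \<otimes> Poly_Mapping.single v 1)"

definition right_act :: "('n, 'k::field) nctensor \<Rightarrow> ('n, 'k) ncpoly \<Rightarrow> ('n, 'k) nctensor"
  where "right_act t d = lin_ext fscale
    (\<lambda>(u, v). Poly_Mapping.single u 1 \<otimes> (Poly_Mapping.single v 1 * d)) t"

lemma linear_mult_left: "Vector_Spaces.linear fscale fscale (\<lambda>a. a * b)"
  for b :: "('n, 'k::field) ncpoly"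
  by (simp add: Vector_Spaces.linear_iff free_vs.vector_space_axioms distrib_right fscale_mult)

lemma linear_mult_right: "Vector_Spaces.linear fscale fscale (\<lambda>b. a * b)"
  for a :: "('n, 'k::field) ncpoly"
  by (simp add: Vector_Spaces.linear_iff free_vs.vector_space_axioms distrib_left fscale_mult)

lemma linear_left_act: "Vector_Spaces.linear fscale fscale (left_act a)"
  by (simp add: left_act_def)

lemma linear_right_act: "Vector_Spaces.linear fscale fscale (\<lambda>t. right_act t d)"
  by (simp add: right_act_def)

lemma left_act_single:
  "left_act a (Poly_Mapping.single (u, v) 1) = (a * Poly_Mapping.single u 1) \<otimes> Poly_Mapping.single v 1"
  by (simp add: left_act_def)

lemma right_act_single:
  "right_act (Poly_Mapping.single (u, v) 1) d = Poly_Mapping.single u 1 \<otimes> (Poly_Mapping.single v 1 * d)"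
  by (simp add: right_act_def)

lemma left_act_tensor: "left_act a (b \<otimes> c) = (a * b) \<otimes> c"
  by (rule bilinear_eqI[where f = "\<lambda>b c. left_act a (b \<otimes> c)" and g = "\<lambda>b c. (a * b) \<otimes> c"])
     (auto intro: linear_comp[OF linear_tensor_left linear_left_act] linear_tensor_right
        linear_comp[OF linear_tensor_right linear_left_act]
        linear_comp[OF linear_mult_right linear_tensor_left] simp: left_act_single)

lemma right_act_tensor: "right_act (b \<otimes> c) d = b \<otimes> (c * d)"
  by (rule bilinear_eqI[where f = "\<lambda>b c. right_act (b \<otimes> c) d" and g = "\<lambda>b c. b \<otimes> (c * d)"])
     (auto intro: linear_comp[OF linear_tensor_left linear_right_act] linear_tensor_left
        linear_comp[OF linear_tensor_right linear_right_act]
        linear_comp[OF linear_mult_left linear_tensor_right] simp: right_act_single)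

lemma linear_left_act': "Vector_Spaces.linear fscale fscale (\<lambda>a. left_act a t)"
  unfolding left_act_def lin_ext_def[of _ _ t] case_prod_unfold
  by (rule linear_fscale_sum, rule linear_comp[OF linear_mult_left linear_tensor_left])

lemma linear_right_act': "Vector_Spaces.linear fscale fscale (right_act t)"
  unfolding right_act_def[abs_def] lin_ext_def[of _ _ t] case_prod_unfold
  by (rule linear_fscale_sum, rule linear_comp[OF linear_mult_right linear_tensor_right])


section \<open>Difference quotients and cyclic derivatives\<close>

definition is_free_dq :: "'n \<Rightarrow> (('n, 'k::field) ncpoly \<Rightarrow> ('n, 'k) nctensor) \<Rightarrow> bool"
  where "is_free_dq j D \<longleftrightarrow>
    Vector_Spaces.linear fscale fscale D \<and>
    (\<forall>a b. D (a * b) = left_act a (D b) + right_act (D a) b) \<and>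
    (\<forall>k. D (ncvar k) = (if k = j then 1 \<otimes> 1 else 0))"

text \<open>Existence and uniqueness are proved below as \<open>ex1_is_free_dq\<close>.\<close>

definition free_dq :: "'n \<Rightarrow> ('n, 'k::field) ncpoly \<Rightarrow> ('n, 'k) nctensor"
  where "free_dq j = (THE D. is_free_dq j D)"

definition mu_flip :: "('n, 'k::field) nctensor \<Rightarrow> ('n, 'k) ncpoly"
  where "mu_flip = lin_ext fscale (\<lambda>(u, v). Poly_Mapping.single v 1 * Poly_Mapping.single u 1)"

definition cyclic_deriv :: "'n \<Rightarrow> ('n, 'k::field) ncpoly \<Rightarrow> ('n, 'k) ncpoly"
  where "cyclic_deriv j = mu_flip \<circ> free_dq j"

definition number_op :: "('n, 'k::field) ncpoly \<Rightarrow> ('n, 'k) ncpoly"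
  where "number_op = lin_ext fscale
    (\<lambda>w. fscale (of_nat (length (letters w))) (mon (letters w)))"

definition cyc_symm :: "('n, 'k::field) ncpoly \<Rightarrow> ('n, 'k) ncpoly"
  where "cyc_symm = lin_ext fscale
    (\<lambda>w. \<Sum>j=1..length (letters w). mon (drop j (letters w) @ take j (letters w)))"

definition cyclic_subspace :: "('n, 'k::field) ncpoly set"
  where "cyclic_subspace = free_vs.span {cyc_symm (mon w) | w. True}"

lemma mu_flip_tensor: "mu_flip (a \<otimes> b) = b * a"
  for a b :: "('n, 'k::field) ncpoly"
proof -
  have lin: "Vector_Spaces.linear fscale fscale (mu_flip :: ('n, 'k) nctensor \<Rightarrow> _)"
    by (simp add: mu_flip_def)
  have single: "mu_flip (Poly_Mapping.single (u, v) 1) = Poly_Mapping.single v 1 * Poly_Mapping.single u 1"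
    for u v :: "'n ncmon"
    by (simp add: mu_flip_def)
  show ?thesis
    by (rule bilinear_eqI[where f = "\<lambda>a b. mu_flip (a \<otimes> b)" and g = "\<lambda>a b. b * a"])
       (auto intro: linear_comp[OF linear_tensor_left lin] linear_comp[OF linear_tensor_right lin]
          linear_mult_left linear_mult_right simp: single)
qed

lemma number_op_mon: "number_op (mon w) = fscale (of_nat (length w)) (mon w)"
  by (simp add: number_op_def mon_def)

lemma cyc_symm_mon: "cyc_symm (mon w) = (\<Sum>j=1..length w. mon (drop j w @ take j w))"
  by (simp add: cyc_symm_def mon_def)

lemma cyclic_subspace_eq_range: "cyclic_subspace = range (cyc_symm :: ('n, 'k::field) ncpoly \<Rightarrow> _)"
proof -
  have lin: "Vector_Spaces.linear fscale fscale (cyc_symm :: ('n, 'k) ncpoly \<Rightarrow> _)"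
    by (simp add: cyc_symm_def)
  interpret Vector_Spaces.linear fscale fscale "cyc_symm :: ('n, 'k) ncpoly \<Rightarrow> _" by (rule lin)
  have "p \<in> free_vs.span (range mon)" for p :: "('n, 'k) ncpoly"
    by (subst poly_mapping_expand[symmetric])
       (auto intro!: free_vs.span_sum free_vs.span_scale intro: free_vs.span_base
          simp: single_eq_mon)
  then have "free_vs.span (range mon) = (UNIV :: ('n, 'k) ncpoly set)" by blast
  moreover have "{cyc_symm (mon w :: ('n, 'k) ncpoly) | w. True} = cyc_symm ` range mon" by auto
  ultimately show ?thesis
    unfolding cyclic_subspace_def by (simp add: span_image)
qed

definition free_dq_word :: "'n \<Rightarrow> 'n list \<Rightarrow> ('n, 'k::field) nctensor"
  where "free_dq_word j w =
    (\<Sum>i<length w. if w ! i = j then mon (take i w) \<otimes> mon (drop (Suc i) w) else 0)"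

lemma free_dq_word_append:
  "(free_dq_word j (u @ v) :: ('n, 'k::field) nctensor)
    = left_act (mon u) (free_dq_word j v) + right_act (free_dq_word j u) (mon v)"
proof -
  interpret L: Vector_Spaces.linear fscale fscale "left_act (mon u :: ('n, 'k) ncpoly)" by (rule linear_left_act)
  interpret R: Vector_Spaces.linear fscale fscale "\<lambda>t. right_act t (mon v :: ('n, 'k) ncpoly)" by (rule linear_right_act)
  have split: "(\<Sum>i<m + n. f i) = (\<Sum>i<m. f i) + (\<Sum>i<n. f (m + i))"
    for m n :: nat and f :: "nat \<Rightarrow> ('n, 'k) nctensor"
    by (induction n) (simp_all add: add.assoc)
  have 1: "left_act (mon u :: ('n, 'k) ncpoly) (free_dq_word j v) =
    (\<Sum>i<length v. if v ! i = j then mon (u @ take i v) \<otimes> mon (drop (Suc i) v) else 0)"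
    unfolding free_dq_word_def L.sum
    by (rule sum.cong) (auto simp: left_act_tensor mon_mult L.zero)
  have 2: "right_act (free_dq_word j u) (mon v :: ('n, 'k) ncpoly) =
    (\<Sum>i<length u. if u ! i = j then mon (take i u) \<otimes> mon (drop (Suc i) u @ v) else 0)"
    unfolding free_dq_word_def R.sum
    by (rule sum.cong) (auto simp: right_act_tensor mon_mult R.zero)
  have 3: "(free_dq_word j (u @ v) :: ('n, 'k) nctensor) =
    (\<Sum>i<length u. if u ! i = j then mon (take i u) \<otimes> mon (drop (Suc i) u @ v) else 0) +
    (\<Sum>i<length v. if v ! i = j then mon (u @ take i v) \<otimes> mon (drop (Suc i) v) else 0)"
    unfolding free_dq_word_def length_append split
    by (intro arg_cong2[where f = "(+)"] sum.cong) (auto simp: nth_append Suc_diff_le)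
  show ?thesis by (simp only: 1 2 3 add.commute)
qed

lemma is_free_dq_word:
  assumes "is_free_dq j D"
  shows "D (mon w) = free_dq_word j w"
proof (induction w)
  case Nil
  interpret L: Vector_Spaces.linear fscale fscale "left_act (1::('a, 'b) ncpoly)" by (rule linear_left_act)
  have l1: "left_act 1 t = t" for t :: "('a, 'b) nctensor"
    by (rule fun_cong[of _ id, simplified], rule linear_eqI[OF linear_left_act free_vs.linear_id])
       (auto simp: left_act_def)
  have r1: "right_act t 1 = t" for t :: "('a, 'b) nctensor"
    by (rule fun_cong[of "\<lambda>t. right_act t 1" id, simplified],
        rule linear_eqI[OF linear_right_act free_vs.linear_id])
       (auto simp: right_act_def)
  have "D (1 * 1) = left_act 1 (D 1) + right_act (D 1) 1"
    using assms unfolding is_free_dq_def by blast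
  then have "D 1 = 0" by (simp add: l1 r1)
  then show ?case by (simp add: mon_Nil free_dq_word_def)
next
  case (Cons a w)
  have v: "D (mon [a]) = free_dq_word j [a]"
    using assms by (simp add: is_free_dq_def ncvar_def free_dq_word_def mon_Nil)
  have "D (mon ([a] @ w)) = left_act (mon [a]) (D (mon w)) + right_act (D (mon [a])) (mon w)"
    using assms unfolding is_free_dq_def mon_mult[symmetric] by blast
  also have "\<dots> = free_dq_word j ([a] @ w)"
    by (simp only: free_dq_word_append Cons.IH v)
  finally show ?case by simp
qed

lemma ex1_is_free_dq: "\<exists>!D :: ('n, 'k::field) ncpoly \<Rightarrow> _. is_free_dq j D"
proof (rule ex1I)
  define D :: "('n, 'k) ncpoly \<Rightarrow> _" where "D = lin_ext fscale (\<lambda>w. free_dq_word j (letters w))"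
  have lin: "Vector_Spaces.linear fscale fscale D" by (simp add: D_def)
  have Dmon: "D (mon w) = free_dq_word j w" for w by (simp add: D_def mon_def)
  have add: "Vector_Spaces.linear fscale fscale (\<lambda>x. f x + g x)"
    if "Vector_Spaces.linear fscale fscale f" "Vector_Spaces.linear fscale fscale g"
    for f g :: "('n, 'k) ncpoly \<Rightarrow> ('n, 'k) nctensor"
    using that by (simp add: Vector_Spaces.linear_iff free_vs.scale_right_distrib)
  have "D (a * b) = left_act a (D b) + right_act (D a) b" for a b
  proof (rule bilinear_eqI[where f = "\<lambda>a b. D (a * b)"
        and g = "\<lambda>a b. left_act a (D b) + right_act (D a) b" and s = fscale])
    show "Vector_Spaces.linear fscale fscale (\<lambda>a. D (a * b))" for b
      by (rule linear_comp[OF linear_mult_left lin])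
    show "Vector_Spaces.linear fscale fscale (\<lambda>b. D (a * b))" for a
      by (rule linear_comp[OF linear_mult_right lin])
    show "Vector_Spaces.linear fscale fscale (\<lambda>a. left_act a (D b) + right_act (D a) b)" for b
      by (intro add linear_left_act' linear_comp[OF lin linear_right_act])
    show "Vector_Spaces.linear fscale fscale (\<lambda>b. left_act a (D b) + right_act (D a) b)" for a
      by (intro add linear_right_act' linear_comp[OF lin linear_left_act])
  qed (simp add: single_eq_mon mon_mult Dmon free_dq_word_append)
  moreover have "D (ncvar k) = (if k = j then 1 \<otimes> 1 else 0)" for k
    by (simp add: ncvar_def Dmon free_dq_word_def mon_Nil)
  ultimately show D: "is_free_dq j D" using lin by (simp add: is_free_dq_def)
  fix E :: "('n, 'k) ncpoly \<Rightarrow> _" assume E: "is_free_dq j E"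
  show "E = D"
    by (rule linear_eqI[OF _ lin])
       (use E in \<open>auto simp: is_free_dq_def single_eq_mon is_free_dq_word[OF E] is_free_dq_word[OF D]\<close>)
qed

lemma is_free_dq_free_dq: "is_free_dq j (free_dq j)"
  unfolding free_dq_def by (rule theI'[OF ex1_is_free_dq])

lemma free_dq_mon: "free_dq j (mon w) =
    (\<Sum>i<length w. if w ! i = j then mon (take i w) \<otimes> mon (drop (Suc i) w) else 0)"
  using is_free_dq_word[OF is_free_dq_free_dq] by (simp add: free_dq_word_def)

end

theory Submission
  imports Defs
begin

text \<open>
  Write \<open>T = \<Sum>\<^sub>j X\<^sub>j P\<^sub>j\<close>; the \<open>P\<^sub>j\<close> are determined by \<open>T\<close>. Since
  \<open>C Q = \<Sum>\<^sub>j X\<^sub>j \<delta>\<^sub>j Q\<close>, condition (i) says that \<open>T = C Q\<close> for some \<open>Q\<close>, which is (iii).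
  As \<open>N (X\<^sub>j p) = X\<^sub>j (N + I) p\<close>, condition (iv) says that \<open>C T = N T\<close>. With the rotation
  \<open>\<rho> (X\<^sub>j p) = p X\<^sub>j\<close>, condition (ii) says that \<open>\<rho> T = T\<close>. Now (iii) implies (ii) because
  \<open>\<rho> C = C\<close>; (ii) implies (iv) because \<open>N - C\<close> factors through \<open>I - \<rho>\<close>; and (iv) implies (iii)
  because \<open>C\<close> commutes with dividing each word by its length, which inverts \<open>N\<close> on
  polynomials without constant term.
\<close>

section \<open>Linear maps on noncommutative polynomials\<close>

lemma linear_ncpoly_eqI:
  fixes p :: "('n, 'k::field) ncpoly"
  assumes "Vector_Spaces.linear fscale s g" "Vector_Spaces.linear fscale s h"
    and "\<And>w. g (mon w) = h (mon w)"
  shows "g p = h p"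
  by (rule fun_cong[OF linear_eqI[OF assms(1,2)]]) (simp only: single_eq_mon assms(3))

lemma linear_fscale_add:
  assumes "Vector_Spaces.linear fscale fscale f" "Vector_Spaces.linear fscale fscale g"
  shows "Vector_Spaces.linear fscale fscale (\<lambda>x. f x + g x)"
  using assms
  by (simp add: Vector_Spaces.linear_iff free_vs.scale_right_distrib algebra_simps)

lemma linear_fscale_diff:
  assumes "Vector_Spaces.linear fscale fscale f" "Vector_Spaces.linear fscale fscale g"
  shows "Vector_Spaces.linear fscale fscale (\<lambda>x. f x - g x)"
  using assms
  by (simp add: Vector_Spaces.linear_iff free_vs.scale_right_diff_distrib algebra_simps)

lemma linear_sum_apply:
  assumes "Vector_Spaces.linear r s f"
  shows "f (\<Sum>i\<in>A. g i) = (\<Sum>i\<in>A. f (g i))"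
proof -
  interpret Vector_Spaces.linear r s f by fact
  show ?thesis by (rule sum)
qed

lemma linear_zero_apply:
  assumes "Vector_Spaces.linear r s f"
  shows "f 0 = 0"
  using linear_sum_apply[OF assms, of "\<lambda>_. 0" "{}"] by simp

lemma linear_diff_apply:
  assumes "Vector_Spaces.linear r s f"
  shows "f (x - y) = f x - f y"
proof -
  interpret Vector_Spaces.linear r s f by fact
  show ?thesis by (rule diff)
qed

lemma linear_fscale_Sum:
  assumes "\<And>k. Vector_Spaces.linear fscale fscale (f k)"
  shows "Vector_Spaces.linear fscale fscale (\<lambda>x. \<Sum>k\<in>A. f k x)"
  using linear_fscale_sum[of f "\<lambda>_. 1" A, OF assms] by simp

lemma linear_free_dq:
  "Vector_Spaces.linear fscale fscale (free_dq j :: ('n, 'k::field) ncpoly \<Rightarrow> _)"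
  by (rule is_free_dq_free_dq[unfolded is_free_dq_def, THEN conjunct1])

lemma linear_mu_flip: "Vector_Spaces.linear fscale fscale mu_flip"
  by (simp add: mu_flip_def)

lemma linear_cyclic_deriv: "Vector_Spaces.linear fscale fscale (cyclic_deriv j)"
  unfolding cyclic_deriv_def comp_def by (rule linear_comp[OF linear_free_dq linear_mu_flip])

lemma linear_cyc_symm: "Vector_Spaces.linear fscale fscale cyc_symm"
  by (simp add: cyc_symm_def)

lemma linear_number_op: "Vector_Spaces.linear fscale fscale number_op"
  by (simp add: number_op_def)

lemma ncvar_mult_mon: "ncvar j * mon w = mon (j # w)"
  by (simp add: ncvar_def mon_mult)

lemma cyclic_deriv_mon:
  "cyclic_deriv j (mon w) =
    (\<Sum>i<length w. if w ! i = j then mon (drop (Suc i) w @ take i w) else 0)"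
  unfolding cyclic_deriv_def comp_apply free_dq_mon linear_sum_apply[OF linear_mu_flip]
  by (intro sum.cong) (auto simp: mu_flip_tensor mon_mult linear_zero_apply[OF linear_mu_flip])

text \<open>Prefixing a letter lengthens every word by one; this is the source of the identity
  summand in \<open>N + I\<close>.\<close>

lemma number_op_ncvar_mult:
  fixes p :: "('n, 'k::field) ncpoly"
  shows "number_op (ncvar j * p) = ncvar j * (number_op p + p)"
proof (rule linear_ncpoly_eqI[where s = fscale and p = p])
  show "number_op (ncvar j * mon w) = (ncvar j * (number_op (mon w) + mon w) :: ('n, 'k) ncpoly)" for w
    by (simp add: ncvar_mult_mon number_op_mon distrib_left fscale_mult_right
        free_vs.scale_left_distrib add.commute)
qed (intro linear_comp[OF linear_mult_right linear_number_op]
    linear_comp[OF linear_fscale_add linear_mult_right] linear_number_op free_vs.linear_ident)+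

section \<open>Decomposition by first letters\<close>

text \<open>A left inverse of multiplication by \<open>ncvar k\<close> from the left, which kills
  the multiples of the other letters. The value at the empty word is set to zero.\<close>

definition strip_first :: "'n \<Rightarrow> ('n, 'k::field) ncpoly \<Rightarrow> ('n, 'k) ncpoly"
  where "strip_first k = lin_ext fscale
    (\<lambda>w. case letters w of [] \<Rightarrow> 0 | a # u \<Rightarrow> if a = k then mon u else 0)"

lemma linear_strip_first: "Vector_Spaces.linear fscale fscale (strip_first k)"
  by (simp add: strip_first_def)

lemma strip_first_ncvar_mult:
  fixes p :: "('n, 'k::field) ncpoly"
  shows "strip_first k (ncvar j * p) = (if j = k then p else 0)"
proof (rule linear_ncpoly_eqI[where s = fscale and p = p])
  show "Vector_Spaces.linear fscale fscale (\<lambda>p :: ('n, 'k) ncpoly. strip_first k (ncvar j * p))"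
    by (rule linear_comp[OF linear_mult_right linear_strip_first])
  show "Vector_Spaces.linear fscale fscale (\<lambda>p :: ('n, 'k) ncpoly. if j = k then p else 0)"
    by (simp add: Vector_Spaces.linear_iff free_vs.vector_space_axioms)
  show "strip_first k (ncvar j * mon w) = (if j = k then mon w else 0 :: ('n, 'k) ncpoly)" for w
    unfolding ncvar_mult_mon by (simp add: mon_def strip_first_def)
qed

text \<open>Applying \<open>strip_first k\<close> isolates the coefficient of the letter
  \<open>k\<close>, so a family of equations indexed by the letters is the same as one equation
  between polynomials.\<close>

lemma sum_ncvar_mult_eq_iff:
  fixes A B :: "'n::finite \<Rightarrow> ('n, 'k::field) ncpoly"
  shows "(\<Sum>j\<in>UNIV. ncvar j * A j) = (\<Sum>j\<in>UNIV. ncvar j * B j) \<longleftrightarrow> (\<forall>j. A j = B j)"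
proof
  have strip: "strip_first k (\<Sum>j\<in>UNIV. ncvar j * D j) = D k"
    for k and D :: "'n \<Rightarrow> ('n, 'k) ncpoly"
    by (simp add: linear_sum_apply[OF linear_strip_first] strip_first_ncvar_mult)
  assume "(\<Sum>j\<in>UNIV. ncvar j * A j) = (\<Sum>j\<in>UNIV. ncvar j * B j)"
  then show "\<forall>j. A j = B j" by (metis strip)
qed simp

section \<open>Cyclic symmetrization and rotation\<close>

lemma cyc_symm_mon_rotate:
  "cyc_symm (mon w) = (\<Sum>i<length w. mon (rotate i w) :: ('n, 'k::field) ncpoly)"
proof -
  have "cyc_symm (mon w) = (\<Sum>i<length w. mon (rotate (Suc i) w) :: ('n, 'k) ncpoly)"
    unfolding cyc_symm_mon One_nat_def sum.atLeast1_atMost_eq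
  proof (rule sum.cong)
    fix i assume "i \<in> {..<length w}"
    then show "mon (drop (Suc i) w @ take (Suc i) w) = (mon (rotate (Suc i) w) :: ('n, 'k) ncpoly)"
      \<comment> \<open>\<open>rotate_drop_take\<close> reduces the shift modulo the length, so the
        full rotation is a separate case.\<close>
      by (cases "Suc i = length w") (auto simp: rotate_drop_take)
  qed simp
  \<comment> \<open>The two sums differ in the shifts \<open>0\<close> and \<open>length w\<close>,
    and both of these rotations give \<open>w\<close>.\<close>
  also have "\<dots> = (\<Sum>i<length w. mon (rotate i w))"
    using sum.lessThan_Suc_shift[of "\<lambda>i. mon (rotate i w) :: ('n, 'k) ncpoly" "length w"]
    by (simp add: add.commute)
  finally show ?thesis .
qed

text \<open>Deleting the letter at position \<open>i\<close> and reading on cyclically gives a term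
  of its cyclic derivative; putting the letter back in front gives the rotation by
  \<open>i\<close>.\<close>

lemma cyc_symm_eq_sum_ncvar_cyclic_deriv:
  fixes p :: "('n::finite, 'k::field) ncpoly"
  shows "cyc_symm p = (\<Sum>j\<in>UNIV. ncvar j * cyclic_deriv j p)"
proof (rule linear_ncpoly_eqI[where p = p, OF linear_cyc_symm])
  show "Vector_Spaces.linear fscale fscale
      (\<lambda>p :: ('n, 'k) ncpoly. \<Sum>j\<in>UNIV. ncvar j * cyclic_deriv j p)"
    by (intro linear_fscale_Sum linear_comp[OF linear_cyclic_deriv linear_mult_right])
  fix w :: "'n list"
  have "(\<Sum>j\<in>UNIV. ncvar j * cyclic_deriv j (mon w) :: ('n, 'k) ncpoly) =
      (\<Sum>j\<in>UNIV. \<Sum>i<length w. if w ! i = j then mon (w ! i # drop (Suc i) w @ take i w) else 0)"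
    unfolding cyclic_deriv_mon sum_distrib_left
    by (intro sum.cong) (auto simp: ncvar_mult_mon)
  also have "\<dots> = (\<Sum>i<length w. mon (w ! i # drop (Suc i) w @ take i w))"
    \<comment> \<open>For a fixed position \<open>i\<close>, only the letter
      \<open>j = w ! i\<close> contributes.\<close>
    by (subst sum.swap) simp
  also have "\<dots> = (\<Sum>i<length w. mon (rotate i w))"
    by (intro sum.cong) (auto simp: rotate_drop_take Cons_nth_drop_Suc simp flip: append_Cons)
  finally show "cyc_symm (mon w :: ('n, 'k) ncpoly) = (\<Sum>j\<in>UNIV. ncvar j * cyclic_deriv j (mon w))"
    by (simp add: cyc_symm_mon_rotate)
qed

definition rot :: "('n, 'k::field) ncpoly \<Rightarrow> ('n, 'k) ncpoly"
  where "rot = lin_ext fscale (\<lambda>w. mon (rotate1 (letters w)))"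

lemma linear_rot: "Vector_Spaces.linear fscale fscale rot"
  by (simp add: rot_def)

lemma rot_mon: "rot (mon w) = mon (rotate1 w)"
  by (simp add: rot_def mon_def)

text \<open>This makes \<open>commutator (ncvar j) p\<close> the difference between
  \<open>ncvar j * p\<close> and its rotation.\<close>

lemma rot_ncvar_mult:
  fixes p :: "('n, 'k::field) ncpoly"
  shows "rot (ncvar j * p) = p * ncvar j"
proof (rule linear_ncpoly_eqI[where s = fscale and p = p])
  show "rot (ncvar j * mon w) = (mon w * ncvar j :: ('n, 'k) ncpoly)" for w
    by (simp add: ncvar_mult_mon rot_mon) (simp add: ncvar_def mon_mult)
qed (intro linear_comp[OF linear_mult_right linear_rot] linear_mult_left)+

text \<open>Rotating once more only permutes the rotations of a word.\<close>

lemma rot_cyc_symm: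
  fixes p :: "('n, 'k::field) ncpoly"
  shows "rot (cyc_symm p) = cyc_symm p"
proof (rule linear_ncpoly_eqI[where p = p, OF linear_comp[OF linear_cyc_symm linear_rot] linear_cyc_symm])
  fix w :: "'n list"
  have "rot (cyc_symm (mon w)) = (\<Sum>i<length w. mon (rotate (Suc i) w) :: ('n, 'k) ncpoly)"
    by (simp add: cyc_symm_mon_rotate linear_sum_apply[OF linear_rot] rot_mon)
  also have "\<dots> = (\<Sum>i<length w. mon (rotate i w))"
    using sum.lessThan_Suc_shift[of "\<lambda>i. mon (rotate i w) :: ('n, 'k) ncpoly" "length w"]
    by (simp add: add.commute)
  finally show "rot (cyc_symm (mon w)) = (cyc_symm (mon w) :: ('n, 'k) ncpoly)"
    by (simp add: cyc_symm_mon_rotate)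
qed

lemma cyc_symm_eq_number_op:
  fixes p :: "('n, 'k::field) ncpoly"
  assumes "rot p = p"
  shows "cyc_symm p = number_op p"
proof -
  \<comment> \<open>With r for \<open>rot\<close>, \<open>G\<close> is the sum over j of 1 + r + ...
    + r^(j-1), the quotient of 1 - r^j by 1 - r. On a word of length n, N - C is the sum of 1 - r^j
    over j < n.\<close>
  define G :: "('n, 'k) ncpoly \<Rightarrow> ('n, 'k) ncpoly"
    where "G = lin_ext fscale
      (\<lambda>w. \<Sum>j<length (letters w). \<Sum>i<j. mon (rotate i (letters w)))"
  have lin: "Vector_Spaces.linear fscale fscale G" by (simp add: G_def)
  have G_mon: "G (mon w) = (\<Sum>j<length w. \<Sum>i<j. mon (rotate i w))" for w
    by (simp add: G_def mon_def)
  have "number_op q - cyc_symm q = G (q - rot q)" for q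
  proof (rule linear_ncpoly_eqI[where s = fscale and p = q])
    fix w :: "'n list"
    have "G (mon w - rot (mon w)) =
        (\<Sum>j<length w. \<Sum>i<j. mon (rotate i w) - mon (rotate (Suc i) w))"
      by (simp add: linear_diff_apply[OF lin] rot_mon G_mon rotate1_rotate_swap sum_subtractf)
    also have "\<dots> = (\<Sum>j<length w. mon w - mon (rotate j w))"
      by (subst sum_lessThan_telescope') simp
    also have "\<dots> = number_op (mon w) - cyc_symm (mon w)"
      by (simp add: sum_subtractf number_op_mon cyc_symm_mon_rotate fscale_conv_mult single_of_nat)
    finally show "number_op (mon w) - cyc_symm (mon w) = G (mon w - rot (mon w))" by simp
  qed (intro linear_fscale_diff linear_number_op linear_cyc_symm linear_comp[OF _ lin]
      free_vs.linear_ident linear_rot)+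
  from this[of p] show ?thesis
    using assms by (simp add: linear_zero_apply[OF lin])
qed

text \<open>The empty word is sent to \<open>0\<close>, since \<open>1 / 0 = 0\<close>.\<close>

definition div_length :: "('n, 'k::field) ncpoly \<Rightarrow> ('n, 'k) ncpoly"
  where "div_length = lin_ext fscale
    (\<lambda>w. fscale (1 / of_nat (length (letters w))) (mon (letters w)))"

lemma linear_div_length: "Vector_Spaces.linear fscale fscale div_length"
  by (simp add: div_length_def)

lemma div_length_mon: "div_length (mon w) = fscale (1 / of_nat (length w)) (mon w)"
  by (simp add: div_length_def mon_def)

text \<open>All rotations of a word have the same length, hence the same scalar.\<close>

lemma cyc_symm_div_length:
  fixes p :: "('n, 'k::field) ncpoly"
  shows "cyc_symm (div_length p) = div_length (cyc_symm p)"
proof (rule linear_ncpoly_eqI[where s = fscale and p = p])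
  show "cyc_symm (div_length (mon w)) = (div_length (cyc_symm (mon w)) :: ('n, 'k) ncpoly)" for w
    by (simp add: div_length_mon linearD(2)[OF linear_cyc_symm] cyc_symm_mon_rotate
        linear_sum_apply[OF linear_div_length] free_vs.scale_sum_right)
qed (intro linear_comp[OF linear_div_length linear_cyc_symm]
    linear_comp[OF linear_cyc_symm linear_div_length])+

text \<open>The leading letter makes the length positive, and characteristic zero makes it
  invertible in the field.\<close>

lemma div_length_number_op_ncvar_mult:
  fixes p :: "('n, 'k::field_char_0) ncpoly"
  shows "div_length (number_op (ncvar j * p)) = ncvar j * p"
proof (rule linear_ncpoly_eqI[where s = fscale and p = p])
  show "div_length (number_op (ncvar j * mon w)) = (ncvar j * mon w :: ('n, 'k) ncpoly)" for w
    using of_nat_neq_0[of "length w", where ?'a = 'k]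
    by (simp add: ncvar_mult_mon number_op_mon linearD(2)[OF linear_div_length] div_length_mon
        del: of_nat_Suc)
qed (intro linear_comp[OF linear_comp[OF linear_mult_right linear_number_op] linear_div_length]
    linear_mult_right)+

theorem theorem1:
  fixes P :: "'n::finite \<Rightarrow> ('n, 'k::field_char_0) ncpoly"
  shows "((\<exists>Q :: ('n, 'k) ncpoly. \<forall>j. cyclic_deriv j Q = P j)
            \<longleftrightarrow> (\<Sum>j\<in>UNIV. commutator (ncvar j) (P j)) = 0) \<and>
         ((\<Sum>j\<in>UNIV. commutator (ncvar j) (P j)) = 0
            \<longleftrightarrow> (\<Sum>j\<in>UNIV. ncvar j * P j) \<in> cyclic_subspace) \<and>
         ((\<Sum>j\<in>UNIV. ncvar j * P j) \<in> cyclic_subspace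
            \<longleftrightarrow> (\<forall>k. cyclic_deriv k (\<Sum>j\<in>UNIV. ncvar j * P j) = number_op (P k) + P k))"
proof -
  define T where "T = (\<Sum>j\<in>UNIV. ncvar j * P j)"
  \<comment> \<open>Comparing the coefficients of each letter in \<open>T = cyc_symm Q\<close> gives
    the equations of (i).\<close>
  have i: "(\<exists>Q. \<forall>j. cyclic_deriv j Q = P j) \<longleftrightarrow> T \<in> cyclic_subspace"
    unfolding cyclic_subspace_eq_range image_iff cyc_symm_eq_sum_ncvar_cyclic_deriv T_def
      sum_ncvar_mult_eq_iff by (auto simp: eq_commute[of "P _"])
  have "(\<Sum>j\<in>UNIV. commutator (ncvar j) (P j)) = T - rot T"
    by (simp add: T_def commutator_def linear_sum_apply[OF linear_rot] rot_ncvar_mult sum_subtractf)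
  then have ii: "(\<Sum>j\<in>UNIV. commutator (ncvar j) (P j)) = 0 \<longleftrightarrow> rot T = T"
    by auto
  have "number_op T = (\<Sum>k\<in>UNIV. ncvar k * (number_op (P k) + P k))"
    by (simp add: T_def linear_sum_apply[OF linear_number_op] number_op_ncvar_mult)
  then have iv: "(\<forall>k. cyclic_deriv k T = number_op (P k) + P k) \<longleftrightarrow> cyc_symm T = number_op T"
    by (simp only: cyc_symm_eq_sum_ncvar_cyclic_deriv[of T] sum_ncvar_mult_eq_iff)
  have "rot T = T" if "T \<in> cyclic_subspace"
    using that by (auto simp: cyclic_subspace_eq_range rot_cyc_symm)
  moreover have "cyc_symm T = number_op T" if "rot T = T"
    using that by (rule cyc_symm_eq_number_op)
  moreover have "T \<in> cyclic_subspace" if "cyc_symm T = number_op T"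
  proof -
    \<comment> \<open>The preimage of \<open>T\<close> under \<open>cyc_symm\<close> is
      \<open>div_length T\<close>; every word of \<open>T\<close> starts with a letter, so no
      constant term is lost.\<close>
    have "cyc_symm (div_length T) = div_length (number_op T)"
      by (simp only: cyc_symm_div_length that)
    also have "\<dots> = T"
      by (simp add: T_def linear_sum_apply[OF linear_number_op]
          linear_sum_apply[OF linear_div_length] div_length_number_op_ncvar_mult)
    finally show ?thesis
      unfolding cyclic_subspace_eq_range by (metis rangeI)
  qed
  ultimately show ?thesis
    using i ii iv unfolding T_def[symmetric] by blast
qed

end
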